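(* Let $S$ be a semiring and let $\Gamma \subseteq \mathrm{Spec}(S)$ satisfy the prime avoidance property. Let $B$ be an amount $S$-semialgebra with amount function $A: B\to\mathrm{Id}(S)$. If $Z(S)$ is controlled by $\Gamma$ and the $S$-semialgebra $B$ is McCoy and has Property (A) (both with respect to $A$), then $Z(B)$ is controlled by the set of all $\mathfrak{p}^{\epsilon}$ with $\mathfrak{p} \in \Gamma$; that is, the $\mathfrak p^\epsilon$ are prime ideals of $B$ and $Z(B)=\bigcup_{\mathfrak p\in\Gamma}\mathfrak p^{\epsilon}$.
   Context: A semiring is a set $S$ with operations $+,\cdot$ such that $(S,+,0)$ and $(S,\cdot,1)$ are commutative monoids with $1\neq 0$, multiplication distributes over addition, and $s\cdot 0=0$ for all $s$. An ideal of $S$ is a nonempty subset closed under addition and under multiplication by elements of $S$; $\mathrm{Id}(S)$ is the set of ideals of $S$. A proper ideal $\mathfrak p$ is prime if $ab\in\mathfrak p$ implies $a\in\mathfrak p$ or $b\in\mathfrak p$; $\mathrm{Spec}(S)$ is the set of prime ideals. $IJ$ is the ideal of finite sums of products $xy$, $x\in I$, $y\in J$; $I^0=S$. $Z(S)$ is the set of zero-divisors of $S$, i.e. of $z\in S$ with $zs=0$ for some nonzero $s\in S$ (so $0\in Z(S)$). For a set $\Gamma\subseteq\mathrm{Spec}(S)$: $Z(S)$ is controlled by $\Gamma$ if $Z(S)=\bigcup_{\mathfrak p\in\Gamma}\mathfrak p$; $\Gamma$ satisfies the prime avoidance property if for every ideal $I$ of $S$, $I\subseteq\bigcup_{\mathfrak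 p\in\Gamma}\mathfrak p$ implies $I\subseteq\mathfrak p$ for some $\mathfrak p\in\Gamma$. An $S$-semialgebra is a semiring $B$ together with a semiring morphism $\gamma: S\to B$ (preserving $+,\cdot,0,1$); write $sf=\gamma(s)f$. An amount function is a function $A: B\to \mathrm{Id}(S)$, $f\mapsto A_f$, such that for all $s\in S$, $f,g\in B$: (1) $A_0=(0)$ and $A_1=S$; (2) $A_f=(0)$ implies $f=0$; (3) $A_{sf}=sA_f$; (4) $A_{fg}\subseteq A_fA_g$. $B$ is an amount $S$-semialgebra if: (i) there is an amount function $A: B\to\mathrm{Id}(S)$ such that for all $f,g\in B$ there are non-negative integers $m,n$ with $A_f^mA_g^nA_{fg}=A_f^{m+1}A_g^{n+1}$; and (ii) there is a function $\epsilon:\mathrm{Id}(S)\to\mathrm{Id}(B)$, $I\mapsto I^{\epsilon}$, such that $A_f\subseteq I$ if and only if $f\in I^\epsilon$ (for all $f\in B$, $I\in \mathrm{Id}(S)$), and $I^{\epsilon}\cap S=I$ for all $I$ (where $I^\epsilon\cap S$ means $\gamma^{-1}(I^\epsilon)$). With respect to $A$: $B$ is a McCoy $S$-semialgebra if for all $f,g\in B$, $fg=0$ and $g\neq0$ imply that there is a nonzero $s\in S$ with $sA_f=(0)$; $B$ has Property (A) if for all $f\in B$, $A_f\subseteq Z(S)$ implies that there is a nonzero $s\in S$ with $sA_f=(0)$. *)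

theory Defs
  imports Main
begin

text \<open>The semirings considered are commutative with \<open>1 \<noteq> 0\<close>, which is exactly the class
  \<^class>\<open>comm_semiring_1\<close>.\<close>

definition semiring_ideal :: "'a::comm_semiring_1 set \<Rightarrow> bool" where
  "semiring_ideal I \<longleftrightarrow>
     I \<noteq> {} \<and> (\<forall>x\<in>I. \<forall>y\<in>I. x + y \<in> I) \<and> (\<forall>s. \<forall>x\<in>I. s * x \<in> I)"

definition Ideals :: "'a::comm_semiring_1 set set" where
  "Ideals = {I. semiring_ideal I}"

definition semiring_prime_ideal :: "'a::comm_semiring_1 set \<Rightarrow> bool" where
  "semiring_prime_ideal P \<longleftrightarrow>
     semiring_ideal P \<and> P \<noteq> UNIV \<and> (\<forall>a b. a * b \<in> P \<longrightarrow> a \<in> P \<or> b \<in> P)"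

definition Spec :: "'a::comm_semiring_1 set set" where
  "Spec = {P. semiring_prime_ideal P}"

definition ideal_mult :: "'a::comm_semiring_1 set \<Rightarrow> 'a set \<Rightarrow> 'a set" (infixl \<open>\<cdot>\<^sub>I\<close> 70) where
  "I \<cdot>\<^sub>I J = {\<Sum>i<n. x i * y i | (n::nat) x y. \<forall>i<n. x i \<in> I \<and> y i \<in> J}"

primrec ideal_power :: "'a::comm_semiring_1 set \<Rightarrow> nat \<Rightarrow> 'a set" (infixr \<open>^\<^sub>I\<close> 80) where
  "I ^\<^sub>I 0 = UNIV"
| "I ^\<^sub>I Suc n = I \<cdot>\<^sub>I (I ^\<^sub>I n)"

definition scale_set :: "'a::comm_semiring_1 \<Rightarrow> 'a set \<Rightarrow> 'a set" (infixr \<open>\<cdot>\<^sub>s\<close> 75) where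
  "s \<cdot>\<^sub>s I = (\<lambda>x. s * x) ` I"

definition zero_divisors :: "'a::comm_semiring_1 set" where
  "zero_divisors = {z. \<exists>s. s \<noteq> 0 \<and> z * s = 0}"

definition zero_divisors_controlled_by :: "'a::comm_semiring_1 set set \<Rightarrow> bool" where
  "zero_divisors_controlled_by \<Gamma> \<longleftrightarrow> \<Gamma> \<subseteq> Spec \<and> zero_divisors = \<Union>\<Gamma>"

definition prime_avoidance :: "'a::comm_semiring_1 set set \<Rightarrow> bool" where
  "prime_avoidance \<Gamma> \<longleftrightarrow> (\<forall>I\<in>Ideals. I \<subseteq> \<Union>\<Gamma> \<longrightarrow> (\<exists>P\<in>\<Gamma>. I \<subseteq> P))"

definition semiring_morphism :: "('s::comm_semiring_1 \<Rightarrow> 'b::comm_semiring_1) \<Rightarrow> bool" where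
  "semiring_morphism \<gamma> \<longleftrightarrow>
     \<gamma> 0 = 0 \<and> \<gamma> 1 = 1 \<and> (\<forall>x y. \<gamma> (x + y) = \<gamma> x + \<gamma> y) \<and> (\<forall>x y. \<gamma> (x * y) = \<gamma> x * \<gamma> y)"

text \<open>An \<open>S\<close>-semialgebra is given by its structure morphism \<open>\<gamma>\<close>, the scalar product \<open>s f\<close> being
  \<open>\<gamma> s * f\<close>.\<close>

definition amount_function ::
    "('s::comm_semiring_1 \<Rightarrow> 'b::comm_semiring_1) \<Rightarrow> ('b \<Rightarrow> 's set) \<Rightarrow> bool" where
  "amount_function \<gamma> A \<longleftrightarrow>
     (\<forall>f. A f \<in> Ideals) \<and>
     A 0 = {0} \<and> A 1 = UNIV \<and>
     (\<forall>f. A f = {0} \<longrightarrow> f = 0) \<and>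
     (\<forall>s f. A (\<gamma> s * f) = s \<cdot>\<^sub>s A f) \<and>
     (\<forall>f g. A (f * g) \<subseteq> A f \<cdot>\<^sub>I A g)"

text \<open>Only the values of \<open>\<epsilon>\<close> on ideals matter; it stands for a function from
  the ideals of \<open>S\<close> to the ideals of \<open>B\<close>.\<close>

definition amount_semialgebra ::
    "('s::comm_semiring_1 \<Rightarrow> 'b::comm_semiring_1) \<Rightarrow> ('b \<Rightarrow> 's set) \<Rightarrow> ('s set \<Rightarrow> 'b set) \<Rightarrow> bool"
  where
  "amount_semialgebra \<gamma> A \<epsilon> \<longleftrightarrow>
     semiring_morphism \<gamma> \<and>
     amount_function \<gamma> A \<and>
     (\<forall>f g. \<exists>m n. A f ^\<^sub>I m \<cdot>\<^sub>I A g ^\<^sub>I n \<cdot>\<^sub>I A (f * g) = A f ^\<^sub>I (m + 1) \<cdot>\<^sub>I A g ^\<^sub>I (n + 1)) \<and>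
     (\<forall>I\<in>Ideals. \<epsilon> I \<in> Ideals) \<and>
     (\<forall>f. \<forall>I\<in>Ideals. A f \<subseteq> I \<longleftrightarrow> f \<in> \<epsilon> I) \<and>
     (\<forall>I\<in>Ideals. \<gamma> -` \<epsilon> I = I)"

definition McCoy :: "('b::comm_semiring_1 \<Rightarrow> 's::comm_semiring_1 set) \<Rightarrow> bool" where
  "McCoy A \<longleftrightarrow> (\<forall>f g. f * g = 0 \<and> g \<noteq> 0 \<longrightarrow> (\<exists>s. s \<noteq> 0 \<and> s \<cdot>\<^sub>s A f = {0}))"

definition property_A :: "('b::comm_semiring_1 \<Rightarrow> 's::comm_semiring_1 set) \<Rightarrow> bool" where
  "property_A A \<longleftrightarrow> (\<forall>f. A f \<subseteq> zero_divisors \<longrightarrow> (\<exists>s. s \<noteq> 0 \<and> s \<cdot>\<^sub>s A f = {0}))"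

end

theory Submission imports Defs begin

text \<open>Primes extend to primes: if \<open>fg \<in> \<pp>\<^sup>\<epsilon>\<close>, then \<open>A\<^bsub>f\<^esub>\<^bsup>m+1\<^esup> A\<^bsub>g\<^esub>\<^bsup>n+1\<^esup> \<subseteq> A\<^bsub>fg\<^esub> \<subseteq> \<pp>\<close>, which forces
  \<open>A\<^bsub>f\<^esub> \<subseteq> \<pp>\<close> or \<open>A\<^bsub>g\<^esub> \<subseteq> \<pp>\<close>. For the union, the McCoy property and
  Property (A) show that \<open>f\<close> is a zero-divisor iff \<open>A\<^bsub>f\<^esub> \<subseteq> Z(S)\<close>, which by prime avoidance means
  \<open>A\<^bsub>f\<^esub> \<subseteq> \<pp>\<close>, i.e. \<open>f \<in> \<pp>\<^sup>\<epsilon>\<close>, for some \<open>\<pp> \<in> \<Gamma>\<close>.\<close>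

lemma semiring_ideal_zero:
  assumes "semiring_ideal I"
  shows "0 \<in> I"
proof -
  obtain x where "x \<in> I" using assms by (auto simp: semiring_ideal_def)
  then have "0 * x \<in> I" using assms unfolding semiring_ideal_def by blast
  then show ?thesis by simp
qed

lemma semiring_ideal_sum:
  assumes "semiring_ideal I" "\<And>i. i < n \<Longrightarrow> f i \<in> I"
  shows "(\<Sum>i<(n::nat). f i) \<in> I"
  using assms(2)
proof (induction n)
  case 0
  then show ?case by (simp add: semiring_ideal_zero[OF assms(1)])
next
  case (Suc n)
  then show ?case using assms(1) by (simp add: semiring_ideal_def)
qed

lemma ideal_mult_subset_right:
  assumes "semiring_ideal P" "K \<subseteq> P"
  shows "J \<cdot>\<^sub>I K \<subseteq> P"
proof
  fix z assume "z \<in> J \<cdot>\<^sub>I K"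
  then obtain n :: nat and x y
    where z: "z = (\<Sum>i<n. x i * y i)" and xy: "\<And>i. i < n \<Longrightarrow> y i \<in> K"
    unfolding ideal_mult_def by blast
  have "x i * y i \<in> P" if "i < n" for i
    using assms xy[OF that] unfolding semiring_ideal_def by blast
  then show "z \<in> P" unfolding z by (rule semiring_ideal_sum[OF assms(1)])
qed

lemma mult_in_ideal_mult:
  assumes "x \<in> I" "y \<in> J"
  shows "x * y \<in> I \<cdot>\<^sub>I J"
proof -
  have "x * y = (\<Sum>i<(1::nat). x * y)" by simp
  then show ?thesis unfolding ideal_mult_def using assms
    by (intro CollectI exI[of _ 1] exI[of _ "\<lambda>_. x"] exI[of _ "\<lambda>_. y"]) simp
qed

lemma power_in_ideal_power: "x \<in> I \<Longrightarrow> x ^ n \<in> I ^\<^sub>I n"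
  by (induction n) (simp_all add: mult_in_ideal_mult)

lemma semiring_prime_ideal_power:
  assumes "semiring_prime_ideal P" "x ^ n \<in> P"
  shows "x \<in> P"
  using assms(2)
proof (induction n)
  case 0
  \<comment> \<open>Here \<open>x ^ 0 = 1\<close> lies in \<open>P\<close>, so \<open>P\<close>
    absorbs every \<open>s * 1\<close>; this contradicts properness.\<close>
  then have "s * 1 \<in> P" for s
    using assms(1) unfolding semiring_prime_ideal_def semiring_ideal_def power_0 by blast
  then have "P = UNIV" by auto
  with assms(1) show ?case by (simp add: semiring_prime_ideal_def)
next
  case (Suc n)
  then show ?case using assms(1) by (auto simp: semiring_prime_ideal_def)
qed

text \<open>Elements \<open>a\<close> of \<open>I\<close> and \<open>b\<close> of \<open>J\<close>
  outside \<open>P\<close> would have \<open>a ^ m * b ^ n\<close> outside \<open>P\<close> as well,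
  since \<open>P\<close> is prime, yet this element lies in the product of the powers.\<close>

lemma prime_ideal_power_mult_subset:
  assumes P: "semiring_prime_ideal P" and sub: "I ^\<^sub>I m \<cdot>\<^sub>I J ^\<^sub>I n \<subseteq> P"
  shows "I \<subseteq> P \<or> J \<subseteq> P"
proof (rule ccontr)
  assume "\<not> ?thesis"
  then obtain a b where ab: "a \<in> I" "b \<in> J" "a \<notin> P" "b \<notin> P" by blast
  have "a ^ m * b ^ n \<in> P"
    using mult_in_ideal_mult[OF ab(1,2)[THEN power_in_ideal_power]] sub by (rule subsetD[rotated])
  then have "a ^ m \<in> P \<or> b ^ n \<in> P" using P by (simp add: semiring_prime_ideal_def)
  then show False using ab P semiring_prime_ideal_power by blast
qed

lemma extension_prime:
  assumes B: "amount_semialgebra \<gamma> A \<epsilon>" and P: "semiring_prime_ideal P"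
  shows "semiring_prime_ideal (\<epsilon> P)"
proof -
  have ideal: "P \<in> Ideals" using P by (simp add: Ideals_def semiring_prime_ideal_def)
  have mem: "A f \<subseteq> P \<longleftrightarrow> f \<in> \<epsilon> P" for f
    using B ideal unfolding amount_semialgebra_def by blast
  have "semiring_ideal (\<epsilon> P)"
    using B ideal unfolding amount_semialgebra_def Ideals_def by blast
  moreover have "1 \<notin> \<epsilon> P"
  proof -
    have "A 1 = UNIV"
      using B unfolding amount_semialgebra_def amount_function_def by (elim conjE)
    then show ?thesis using mem[of 1] P by (auto simp: semiring_prime_ideal_def)
  qed
  moreover have "f \<in> \<epsilon> P \<or> g \<in> \<epsilon> P" if fg: "f * g \<in> \<epsilon> P" for f g
  proof -
    have "\<forall>f g. \<exists>m n. A f ^\<^sub>I m \<cdot>\<^sub>I A g ^\<^sub>I n \<cdot>\<^sub>I A (f * g) = A f ^\<^sub>I (m + 1) \<cdot>\<^sub>I A g ^\<^sub>I (n + 1)"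
      using B unfolding amount_semialgebra_def by (elim conjE)
    then obtain m n where "A f ^\<^sub>I m \<cdot>\<^sub>I A g ^\<^sub>I n \<cdot>\<^sub>I A (f * g) = A f ^\<^sub>I (m + 1) \<cdot>\<^sub>I A g ^\<^sub>I (n + 1)"
      by metis
    \<comment> \<open>The product associates to the left, so \<open>A (f * g)\<close> is its right
      factor; it is contained in \<open>P\<close> because \<open>f * g\<close> lies in
      \<open>\<epsilon> P\<close>.\<close>
    moreover have "A f ^\<^sub>I m \<cdot>\<^sub>I A g ^\<^sub>I n \<cdot>\<^sub>I A (f * g) \<subseteq> P"
      using P fg mem by (intro ideal_mult_subset_right) (simp_all add: semiring_prime_ideal_def)
    ultimately have "A f ^\<^sub>I (m + 1) \<cdot>\<^sub>I A g ^\<^sub>I (n + 1) \<subseteq> P" by simp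
    then have "A f \<subseteq> P \<or> A g \<subseteq> P" by (rule prime_ideal_power_mult_subset[OF P])
    then show ?thesis by (simp only: mem)
  qed
  ultimately show ?thesis unfolding semiring_prime_ideal_def by blast
qed

text \<open>The witness is \<open>\<gamma> s\<close>: the amount of \<open>\<gamma> s * f\<close> is
  \<open>s \<cdot>\<^sub>s A f = {0}\<close>, and only 0 has zero amount.\<close>

lemma annihilated_amount_imp_zero_divisor:
  assumes B: "amount_function \<gamma> A" and s: "s \<noteq> 0" "s \<cdot>\<^sub>s A f = {0}"
  shows "f \<in> zero_divisors"
proof -
  have scale: "A (\<gamma> s * g) = s \<cdot>\<^sub>s A g" for g
    using B unfolding amount_function_def by metis
  have zero: "A 0 = {0}" and one: "A 1 = UNIV"
    using B unfolding amount_function_def by simp_all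
  have eq_zero: "g = 0" if "A g = {0}" for g
    using B that unfolding amount_function_def by metis
  have "\<gamma> s * f = 0"
    using s(2) scale[of f] by (intro eq_zero) simp
  then have "f * \<gamma> s = 0" by (simp only: mult.commute)
  \<comment> \<open>Injectivity of \<open>\<gamma>\<close> is not assumed; instead the amount of
    \<open>\<gamma> s * 1\<close> is \<open>s \<cdot>\<^sub>s UNIV\<close>, which contains the
    nonzero \<open>s\<close> and so differs from \<open>A 0\<close>.\<close>
  moreover have "\<gamma> s \<noteq> 0"
  proof
    assume "\<gamma> s = 0"
    then have "s \<cdot>\<^sub>s UNIV = {0}" using scale[of 1] zero one by simp
    moreover have "s * 1 \<in> s \<cdot>\<^sub>s UNIV" unfolding scale_set_def by blast
    ultimately show False using s(1) by simp
  qed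
  ultimately show ?thesis unfolding zero_divisors_def by blast
qed

lemma annihilated_subset_zero_divisors:
  assumes "s \<noteq> 0" "s \<cdot>\<^sub>s I = {0}"
  shows "I \<subseteq> zero_divisors"
proof
  fix x assume "x \<in> I"
  then have "s * x = 0" using assms(2) unfolding scale_set_def by blast
  then have "x * s = 0" by (simp only: mult.commute)
  then show "x \<in> zero_divisors"
    using assms(1) unfolding zero_divisors_def by blast
qed

text \<open>Both sides are equivalent to the existence of a nonzero \<open>s\<close> annihilating
  \<open>A f\<close>: McCoy reaches it from the left side, Property (A) from the right.\<close>

lemma zero_divisor_iff_amount_subset:
  assumes "amount_function \<gamma> A" "McCoy A" "property_A A"
  shows "f \<in> zero_divisors \<longleftrightarrow> A f \<subseteq> zero_divisors"
proof
  assume "f \<in> zero_divisors"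
  then obtain g where "f * g = 0" "g \<noteq> 0" by (auto simp: zero_divisors_def)
  then obtain s where "s \<noteq> 0" "s \<cdot>\<^sub>s A f = {0}" using assms(2) unfolding McCoy_def by blast
  then show "A f \<subseteq> zero_divisors" by (rule annihilated_subset_zero_divisors)
next
  assume "A f \<subseteq> zero_divisors"
  then obtain s where "s \<noteq> 0" "s \<cdot>\<^sub>s A f = {0}" using assms(3) unfolding property_A_def by blast
  then show "f \<in> zero_divisors" by (rule annihilated_amount_imp_zero_divisor[OF assms(1)])
qed

theorem theorem5p2:
  fixes \<gamma> :: "'s::comm_semiring_1 \<Rightarrow> 'b::comm_semiring_1"
    and A :: "'b \<Rightarrow> 's set"
    and \<epsilon> :: "'s set \<Rightarrow> 'b set"
    and \<Gamma> :: "'s set set"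
  assumes "\<Gamma> \<subseteq> Spec"
    and "prime_avoidance \<Gamma>"
    and "amount_semialgebra \<gamma> A \<epsilon>"
    and "zero_divisors_controlled_by \<Gamma>"
    and "McCoy A"
    and "property_A A"
  shows "zero_divisors_controlled_by (\<epsilon> ` \<Gamma>)"
proof -
  have amount: "amount_function \<gamma> A" using assms(3) unfolding amount_semialgebra_def by blast
  have mem: "A f \<subseteq> P \<longleftrightarrow> f \<in> \<epsilon> P" if "P \<in> \<Gamma>" for f P
  proof -
    have "P \<in> Ideals"
      using assms(1) that by (auto simp: Spec_def Ideals_def semiring_prime_ideal_def)
    then show ?thesis using assms(3) unfolding amount_semialgebra_def by blast
  qed
  have "f \<in> zero_divisors \<longleftrightarrow> f \<in> \<Union>(\<epsilon> ` \<Gamma>)" for f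
  proof -
    have "f \<in> zero_divisors \<longleftrightarrow> A f \<subseteq> \<Union>\<Gamma>"
      using zero_divisor_iff_amount_subset[OF amount assms(5,6)] assms(4)
      by (simp add: zero_divisors_controlled_by_def)
    \<comment> \<open>Prime avoidance, applied to the ideal \<open>A f\<close>, gives the forward
      direction; the converse is plain set inclusion.\<close>
    also have "\<dots> \<longleftrightarrow> (\<exists>P\<in>\<Gamma>. A f \<subseteq> P)"
    proof
      have "A f \<in> Ideals" using amount unfolding amount_function_def by blast
      then show "\<exists>P\<in>\<Gamma>. A f \<subseteq> P" if "A f \<subseteq> \<Union>\<Gamma>"
        using assms(2) that unfolding prime_avoidance_def by blast
    qed blast
    also have "\<dots> \<longleftrightarrow> f \<in> \<Union>(\<epsilon> ` \<Gamma>)" using mem by auto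
    finally show ?thesis .
  qed
  moreover have "\<epsilon> ` \<Gamma> \<subseteq> Spec"
    using assms(1) extension_prime[OF assms(3)] by (auto simp: Spec_def)
  ultimately show ?thesis unfolding zero_divisors_controlled_by_def by blast
qed

end
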